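(* Let $f:\mathbb{R}^d\to\mathbb{R}$ be convex and $L$-smooth, let $h:\mathbb{R}^d\to\mathbb{R}\cup\{+\infty\}$ be convex, proper and lower semicontinuous, and suppose $F=f+h$ attains its minimum $F^*=F(x^* )$ at some $x^*\in\mathbb{R}^d$. Let $\{x_k,y_k,z_k\}_{k\ge1}$ be the iterates generated by the full-gradient adaptive accelerated proximal gradient method described in the context, with $y_1=z_1\in\mathrm{dom}(h)$ and parameters $\gamma>0$ and $\eta>\sqrt2D/2$, where $D>0$ is a constant such that $\|z_{k+1}-z_k\|\le D$ and $\|z_k-x^*\|\le D$ for all $k\ge1$. Then there is a constant $c>0$ depending only on $L,\gamma,\eta,D$ and $F(y_1)-F^*$ such that for every $t\ge1$, $$F(y_{t+1})-F^*\le\frac{c}{t^2}.$$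
   Context: $\|\cdot\|$ is the Euclidean norm. $f$ is $L$-smooth if it is continuously differentiable with $L$-Lipschitz gradient. $\mathrm{dom}(h):=\{x:h(x)<+\infty\}$. Full-gradient adaptive accelerated proximal gradient method: set $S_1:=\gamma$, $\alpha_0:=0$. For $k=1,2,\dots$: $\alpha_k:=\frac{1+\sqrt{1+4\alpha_{k-1}^2}}{2}$, $\theta_k:=1/\alpha_k$, $x_k:=(1-\theta_k)y_k+\theta_kz_k$, $g_k:=\nabla f(x_k)$; $$z_{k+1}:=\operatorname*{arg\,min}_{x\in\mathbb{R}^d}\Big\{\langle g_k,x\rangle+\frac{\theta_kS_k}{2\eta}\|x-z_k\|^2+h(x)\Big\},\qquad y_{k+1}:=x_k+\theta_k(z_{k+1}-z_k),$$ $$S_{k+1}^2:=S_k^2\Big(1+\frac{\|z_{k+1}-z_k\|^2}{\eta^2}\Big),\quad S_{k+1}>0.$$ *)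

theory Defs
  imports "HOL-Analysis.Analysis"
begin

text \<open>
  The constant in the theorem must not depend on the dimension $d$, so $d$ has to be quantified inside
  the formula and cannot be the cardinality of an index type. All spaces $R^d$ are therefore
  realised as subspaces of one inner product space, the finitely supported real sequences with
  $\langle x, y\rangle = \sum_i x_i y_i$. (The library's norm on finitely supported functions is
  the $\ell^1$ norm, which is why a separate type is used here.)
\<close>

typedef fsvec = "{x :: nat \<Rightarrow> real. finite {i. x i \<noteq> 0}}"
  morphisms coord Abs_fsvec
  by (rule exI[of _ "\<lambda>_. 0"]) simp

setup_lifting type_definition_fsvec

lemma finite_coord [simp]: "finite {i. coord x i \<noteq> 0}"
  using coord[of x] by simp

lemma fsvec_eq_iff: "x = y \<longleftrightarrow> (\<forall>i. coord x i = coord y i)"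
  by (metis coord_inject ext)

instantiation fsvec :: real_vector
begin

lift_definition zero_fsvec :: fsvec is "\<lambda>_. 0" by simp

lift_definition plus_fsvec :: "fsvec \<Rightarrow> fsvec \<Rightarrow> fsvec" is "\<lambda>x y i. x i + y i"
  subgoal for x y
    by (rule finite_subset[of _ "{i. x i \<noteq> 0} \<union> {i. y i \<noteq> 0}"]) auto
  done

lift_definition minus_fsvec :: "fsvec \<Rightarrow> fsvec \<Rightarrow> fsvec" is "\<lambda>x y i. x i - y i"
  subgoal for x y
    by (rule finite_subset[of _ "{i. x i \<noteq> 0} \<union> {i. y i \<noteq> 0}"]) auto
  done

lift_definition uminus_fsvec :: "fsvec \<Rightarrow> fsvec" is "\<lambda>x i. - x i"
  by simp

lift_definition scaleR_fsvec :: "real \<Rightarrow> fsvec \<Rightarrow> fsvec" is "\<lambda>r x i. r * x i"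
  by (erule finite_subset[rotated]) auto

instance
  by standard (transfer; simp add: fun_eq_iff algebra_simps)+

end

lemma coord_simps [simp]:
  "coord 0 i = 0"
  "coord (x + y) i = coord x i + coord y i"
  "coord (x - y) i = coord x i - coord y i"
  "coord (- x) i = - coord x i"
  "coord (r *\<^sub>R x) i = r * coord x i"
  by (transfer; simp)+

instantiation fsvec :: real_inner
begin

definition inner_fsvec :: "fsvec \<Rightarrow> fsvec \<Rightarrow> real" where
  "inner_fsvec x y = (\<Sum>i | coord x i \<noteq> 0. coord x i * coord y i)"

definition norm_fsvec :: "fsvec \<Rightarrow> real" where
  "norm_fsvec x = sqrt (inner x x)"

definition sgn_fsvec :: "fsvec \<Rightarrow> fsvec" where
  "sgn_fsvec x = x /\<^sub>R norm x"

definition dist_fsvec :: "fsvec \<Rightarrow> fsvec \<Rightarrow> real" where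
  "dist_fsvec x y = norm (x - y)"

definition uniformity_fsvec :: "(fsvec \<times> fsvec) filter" where
  "uniformity_fsvec = (INF e\<in>{0 <..}. principal {(x, y). dist x y < e})"

definition open_fsvec :: "fsvec set \<Rightarrow> bool" where
  "open_fsvec U \<longleftrightarrow> (\<forall>x\<in>U. eventually (\<lambda>(x', y). x' = x \<longrightarrow> y \<in> U) uniformity)"

lemma inner_fsvec_superset:
  assumes "finite A" "{i. coord x i \<noteq> 0} \<subseteq> A"
  shows "inner x y = (\<Sum>i\<in>A. coord x i * coord y i)"
  unfolding inner_fsvec_def using assms by (intro sum.mono_neutral_left) auto

instance
proof
  fix x y z :: fsvec and r :: real
  have fin: "finite ({i. coord x i \<noteq> 0} \<union> {i. coord y i \<noteq> 0})" by simp
  show "inner x y = inner y x"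
    by (subst (1 2) inner_fsvec_superset[OF fin]) (auto simp: mult.commute)
  show "inner (x + y) z = inner x z + inner y z"
    by (subst (1 2 3) inner_fsvec_superset[OF fin]) (auto simp: algebra_simps sum.distrib)
  show "inner (r *\<^sub>R x) y = r * inner x y"
    by (subst (1 2) inner_fsvec_superset[OF finite_coord[of x]])
      (auto simp: algebra_simps sum_distrib_left)
  show "0 \<le> inner x x"
    unfolding inner_fsvec_def by (intro sum_nonneg) simp
  show "inner x x = 0 \<longleftrightarrow> x = 0"
    unfolding inner_fsvec_def by (subst sum_nonneg_eq_0_iff) (auto simp: fsvec_eq_iff)
qed (rule norm_fsvec_def sgn_fsvec_def dist_fsvec_def open_fsvec_def uniformity_fsvec_def)+

end

definition Rn :: "nat \<Rightarrow> fsvec set" where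
  "Rn d = {x. \<forall>i\<ge>d. coord x i = 0}"

lemma inner_Rn: "x \<in> Rn d \<Longrightarrow> inner x y = (\<Sum>i<d. coord x i * coord y i)"
  by (rule inner_fsvec_superset) (auto simp: Rn_def not_less[symmetric])

lemma norm_Rn: "x \<in> Rn d \<Longrightarrow> norm x = sqrt (\<Sum>i<d. (coord x i)\<^sup>2)"
  by (simp add: norm_eq_sqrt_inner inner_Rn power2_eq_square)

lemma coord_Rn_ex1: "\<exists>!x. x \<in> Rn d \<and> (\<forall>i<d. coord x i = v i)"
proof (rule ex1I)
  have "finite {i. (if i < d then v i else 0) \<noteq> 0}"
    by (rule finite_subset[of _ "{..<d}"]) auto
  then show "Abs_fsvec (\<lambda>i. if i < d then v i else 0) \<in> Rn d \<and>
      (\<forall>i<d. coord (Abs_fsvec (\<lambda>i. if i < d then v i else 0)) i = v i)"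
    by (simp add: Rn_def Abs_fsvec_inverse)
next
  fix x assume "x \<in> Rn d \<and> (\<forall>i<d. coord x i = v i)"
  moreover have "finite {i. (if i < d then v i else 0) \<noteq> 0}"
    by (rule finite_subset[of _ "{..<d}"]) auto
  ultimately show "x = Abs_fsvec (\<lambda>i. if i < d then v i else 0)"
    by (auto simp: fsvec_eq_iff Rn_def Abs_fsvec_inverse)
qed

lemma subspace_Rn: "subspace (Rn d)"
  by (auto simp: subspace_def Rn_def)


definition has_gradient :: "nat \<Rightarrow> (fsvec \<Rightarrow> real) \<Rightarrow> fsvec \<Rightarrow> fsvec \<Rightarrow> bool" where
  "has_gradient d f x g \<longleftrightarrow>
     g \<in> Rn d \<and> (f has_derivative (\<lambda>v. inner g v)) (at x within Rn d)"

lemma has_gradient_unique: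
  assumes x: "x \<in> Rn d" and "has_gradient d f x g" "has_gradient d f x g'"
  shows "g = g'"
proof -
  define u where "u = g - g'"
  have u: "u \<in> Rn d"
    using assms subspace_Rn[of d] by (simp add: u_def has_gradient_def subspace_diff)
  have "((\<lambda>w. f w - f w) has_derivative (\<lambda>v. inner g v - inner g' v)) (at x within Rn d)"
    using assms by (intro has_derivative_diff) (auto simp: has_gradient_def)
  then have "((\<lambda>_. 0) has_derivative (\<lambda>v. inner u v)) (at x within Rn d)"
    by (simp add: u_def inner_diff_left)
  moreover have "((\<lambda>t. x + t *\<^sub>R u) has_derivative (\<lambda>t. t *\<^sub>R u)) (at 0)"
    by (auto intro!: derivative_eq_intros)
  moreover have "range (\<lambda>t. x + t *\<^sub>R u) \<subseteq> Rn d"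
    using x u subspace_Rn[of d] by (auto intro: subspace_add subspace_mul)
  ultimately have "((\<lambda>_. 0) has_derivative (\<lambda>t. inner u (t *\<^sub>R u))) (at (0::real))"
    using has_derivative_in_compose[of "\<lambda>t. x + t *\<^sub>R u" "\<lambda>t. t *\<^sub>R u" 0 UNIV "\<lambda>_. 0" "inner u"]
    by (simp add: has_derivative_subset)
  then have "(\<lambda>t. inner u (t *\<^sub>R u)) = (\<lambda>_. 0)"
    by (rule has_derivative_unique) simp
  then have "inner u u = 0"
    by (metis scaleR_one)
  then show ?thesis
    by (simp add: u_def)
qed

definition gradient :: "nat \<Rightarrow> (fsvec \<Rightarrow> real) \<Rightarrow> fsvec \<Rightarrow> fsvec" where
  "gradient d f x = (THE g. has_gradient d f x g)"

definition L_smooth :: "nat \<Rightarrow> real \<Rightarrow> (fsvec \<Rightarrow> real) \<Rightarrow> bool" where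
  "L_smooth d L f \<longleftrightarrow>
     (\<forall>x\<in>Rn d. \<exists>g. has_gradient d f x g) \<and>
     continuous_on (Rn d) (gradient d f) \<and>
     L-lipschitz_on (Rn d) (gradient d f)"

definition domain_of :: "nat \<Rightarrow> (fsvec \<Rightarrow> ereal) \<Rightarrow> fsvec set" where
  "domain_of d h = {x \<in> Rn d. h x < \<infinity>}"

definition proper_fun :: "nat \<Rightarrow> (fsvec \<Rightarrow> ereal) \<Rightarrow> bool" where
  "proper_fun d h \<longleftrightarrow> (\<forall>x\<in>Rn d. h x \<noteq> -\<infinity>) \<and> domain_of d h \<noteq> {}"

text \<open>
  In the extended reals one has $0 \cdot \infty = 0$, so the endpoints $t = 0$ and $t = 1$ are harmless.
\<close>

definition convex_fun :: "nat \<Rightarrow> (fsvec \<Rightarrow> ereal) \<Rightarrow> bool" where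
  "convex_fun d h \<longleftrightarrow>
     (\<forall>x\<in>Rn d. \<forall>y\<in>Rn d. \<forall>t\<in>{0..1}.
        h ((1 - t) *\<^sub>R x + t *\<^sub>R y) \<le> ereal (1 - t) * h x + ereal t * h y)"

definition lsc_fun :: "nat \<Rightarrow> (fsvec \<Rightarrow> ereal) \<Rightarrow> bool" where
  "lsc_fun d h \<longleftrightarrow> (\<forall>x\<in>Rn d. h x \<le> Liminf (at x within Rn d) h)"

definition composite :: "(fsvec \<Rightarrow> real) \<Rightarrow> (fsvec \<Rightarrow> ereal) \<Rightarrow> fsvec \<Rightarrow> ereal" where
  "composite f h x = ereal (f x) + h x"


fun momentum :: "nat \<Rightarrow> real" where
  "momentum 0 = 0"
| "momentum (Suc k) = (1 + sqrt (1 + 4 * (momentum k)\<^sup>2)) / 2"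

text \<open>
  The sequences are indexed from 1; their values at index 0 are irrelevant.
\<close>

definition adaptive_apg ::
  "nat \<Rightarrow> (fsvec \<Rightarrow> real) \<Rightarrow> (fsvec \<Rightarrow> ereal) \<Rightarrow> real \<Rightarrow> real \<Rightarrow>
   (nat \<Rightarrow> real) \<Rightarrow> (nat \<Rightarrow> fsvec) \<Rightarrow> (nat \<Rightarrow> fsvec) \<Rightarrow> (nat \<Rightarrow> fsvec) \<Rightarrow> bool" where
  "adaptive_apg d f h \<gamma> \<eta> S x y z \<longleftrightarrow>
     S 1 = \<gamma> \<and>
     (\<forall>k\<ge>1. let \<theta> = 1 / momentum k; g = gradient d f (x k) in
        x k = (1 - \<theta>) *\<^sub>R y k + \<theta> *\<^sub>R z k \<and>
        is_arg_min
          (\<lambda>u. ereal (inner g u + \<theta> * S k / (2 * \<eta>) * (norm (u - z k))\<^sup>2) + h u)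
          (\<lambda>u. u \<in> Rn d) (z (k + 1)) \<and>
        y (k + 1) = x k + \<theta> *\<^sub>R (z (k + 1) - z k) \<and>
        (S (k + 1))\<^sup>2 = (S k)\<^sup>2 * (1 + (norm (z (k + 1) - z k))\<^sup>2 / \<eta>\<^sup>2) \<and>
        S (k + 1) > 0)"

end

theory Submission
  imports Defs
begin

text \<open>
  With \<open>\<delta>\<^sub>k = norm (z\<^sub>k\<^sub>+\<^sub>1 - z\<^sub>k)\<close> and \<open>r\<^sub>k = norm (z\<^sub>k - x\<^sup>*)\<close>, the usual analysis of the accelerated
  method shows that the energy \<open>\<alpha>\<^sub>k\<^sup>2 (F y\<^sub>k\<^sub>+\<^sub>1 - F x\<^sup>*)\<close> grows in step \<open>k\<close> by at most
  \<open>S\<^sub>k / (2\<eta>) (r\<^sub>k\<^sup>2 - r\<^sub>k\<^sub>+\<^sub>1\<^sup>2) + (L / 2 - S\<^sub>k / (2\<eta>)) \<delta>\<^sub>k\<^sup>2\<close>. Since \<open>S\<close> is increasing, the first part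
  sums to at most \<open>D\<^sup>2 S\<^sub>t\<^sub>+\<^sub>1 / (2\<eta>)\<close>. The recursion for \<open>S\<close> makes the negative terms sum to at most
  \<open>- \<eta> (S\<^sub>t\<^sub>+\<^sub>1 - \<gamma>)\<close> and the sum of the \<open>\<delta>\<^sub>k\<^sup>2\<close> only logarithmic in \<open>S\<^sub>t\<^sub>+\<^sub>1\<close>. As \<open>D\<^sup>2 / (2\<eta>) < \<eta>\<close>,
  the linear term dominates the logarithm, so the energy is bounded whether or not \<open>S\<close> is.
\<close>

section \<open>Smooth convex functions on a convex set\<close>

text \<open>The chain rule along a segment. Derivatives stay relative to \<open>S\<close>, since
  \<open>Rn d\<close> has empty interior in the infinite-dimensional space
  \<open>fsvec\<close>.\<close>

lemma has_derivative_segment: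
  fixes f :: "'a::real_inner \<Rightarrow> real"
  assumes S: "convex S" "x \<in> S" "y \<in> S" and t: "t \<in> {0..1}"
    and der: "(f has_derivative (\<lambda>v. inner g v)) (at (x + t *\<^sub>R (y - x)) within S)"
  shows "((\<lambda>t. f (x + t *\<^sub>R (y - x))) has_real_derivative inner g (y - x)) (at t within {0..1})"
proof -
  have sub: "(\<lambda>t. x + t *\<^sub>R (y - x)) ` {0..1} \<subseteq> S"
    using convexD_alt[OF S(1) S(2) S(3)] by (auto simp: algebra_simps)
  have "((\<lambda>t. x + t *\<^sub>R (y - x)) has_derivative (\<lambda>t. t *\<^sub>R (y - x))) (at t within {0..1})"
    by (auto intro!: derivative_eq_intros)
  from has_derivative_in_compose[OF this has_derivative_subset[OF der sub]]
  show ?thesis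
    by (simp add: has_field_derivative_def mult.commute[of _ "inner g (y - x)"] mult_commute_abs)
qed

text \<open>By convexity the difference quotients along the segment from \<open>x\<close> to
  \<open>y\<close> are at most \<open>f y - f x\<close>, and this bound passes to their limit at
  0.\<close>

lemma convex_on_gradient_ineq:
  fixes f :: "'a::real_inner \<Rightarrow> real"
  assumes "convex_on S f" "x \<in> S" "y \<in> S"
    and der: "(f has_derivative (\<lambda>v. inner g v)) (at x within S)"
  shows "f x + inner g (y - x) \<le> f y"
proof -
  have S: "convex S"
    using assms(1) by (rule convex_on_imp_convex)
  let ?q = "\<lambda>t. (f (x + t *\<^sub>R (y - x)) - f (x + 0 *\<^sub>R (y - x))) / (t - 0)"
  have "((\<lambda>t. f (x + t *\<^sub>R (y - x))) has_real_derivative inner g (y - x)) (at 0 within {0..1})"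
    by (rule has_derivative_segment[OF S assms(2,3)]) (use der in auto)
  then have lim: "(?q \<longlongrightarrow> inner g (y - x)) (at 0 within {0..1})"
    by (simp add: has_field_derivative_iff)
  have "\<forall>\<^sub>F t in at 0 within {0..1::real}. ?q t \<le> f y - f x"
    unfolding eventually_at_filter
  proof (intro always_eventually allI impI)
    fix t :: real assume t: "t \<noteq> 0" "t \<in> {0..1}"
    have "f ((1 - t) *\<^sub>R x + t *\<^sub>R y) \<le> (1 - t) * f x + t * f y"
      using t by (intro convex_onD[OF assms(1)] assms) auto
    then show "?q t \<le> f y - f x"
      using t by (simp add: algebra_simps divide_simps)
  qed
  then have "inner g (y - x) \<le> f y - f x"
    by (rule tendsto_upperbound[OF lim]) (simp add: trivial_limit_within islimpt_Icc)
  then show ?thesis by simp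
qed

lemma lipschitz_gradient_descent:
  fixes f :: "'a::real_inner \<Rightarrow> real"
  assumes S: "convex S" "x \<in> S" "y \<in> S"
    and der: "\<And>u. u \<in> S \<Longrightarrow> (f has_derivative (\<lambda>v. inner (G u) v)) (at u within S)"
    and lip: "L-lipschitz_on S G"
  shows "f y \<le> f x + inner (G x) (y - x) + L / 2 * (norm (y - x))\<^sup>2"
proof -
  define v where "v = y - x"
  \<comment> \<open>The difference between \<open>f\<close> along the segment and the claimed upper
    bound, up to the constant \<open>f x\<close>; the claim is
    \<open>\<psi> 1 \<le> \<psi> 0\<close>.\<close>
  define \<psi> where "\<psi> = (\<lambda>t. f (x + t *\<^sub>R v) - t * inner (G x) v - L / 2 * t\<^sup>2 * (norm v)\<^sup>2)"
  define \<psi>' where "\<psi>' = (\<lambda>t. inner (G (x + t *\<^sub>R v)) v - inner (G x) v - L * t * (norm v)\<^sup>2)"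
  have seg: "x + t *\<^sub>R v \<in> S" if "t \<in> {0..1}" for t
    using convexD_alt[OF S(1) S(2) S(3), of t] that by (auto simp: algebra_simps v_def)
  have d: "(\<psi> has_real_derivative \<psi>' t) (at t within {0..1})" if t: "t \<in> {0..1}" for t
  proof -
    have "((\<lambda>t. f (x + t *\<^sub>R v)) has_real_derivative inner (G (x + t *\<^sub>R v)) v) (at t within {0..1})"
      unfolding v_def
      by (rule has_derivative_segment[OF S t]) (use der seg t in \<open>auto simp: v_def\<close>)
    then show ?thesis
      unfolding \<psi>_def \<psi>'_def
      by (auto intro!: derivative_eq_intros)
  qed
  have neg: "\<psi>' t \<le> 0" if t: "t \<in> {0..1}" for t
  proof -
    have "inner (G (x + t *\<^sub>R v) - G x) v \<le> norm (G (x + t *\<^sub>R v) - G x) * norm v"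
      by (rule norm_cauchy_schwarz)
    also have "\<dots> \<le> (L * norm (t *\<^sub>R v)) * norm v"
      using lipschitz_onD[OF lip seg[OF t] S(2)]
      by (intro mult_right_mono) (auto simp: dist_norm)
    also have "\<dots> = L * t * (norm v)\<^sup>2"
      using t by (simp add: power2_eq_square)
    finally show ?thesis
      by (simp add: \<psi>'_def inner_diff_left)
  qed
  have "\<psi> 1 \<le> \<psi> 0"
  proof (rule DERIV_nonpos_imp_decreasing_open[of 0 1 \<psi>])
    show "\<exists>y. (\<psi> has_real_derivative y) (at t) \<and> y \<le> 0" if "0 < t" "t < 1" for t
      using d[of t] neg[of t] that at_within_Icc_at[of 0 t 1] by auto
    show "continuous_on {0..1} \<psi>"
      using d by (intro DERIV_continuous_on) auto
  qed simp
  then show ?thesis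
    by (simp add: \<psi>_def v_def)
qed

lemma gradient_works:
  assumes "L_smooth d L f" "u \<in> Rn d"
  shows "has_gradient d f u (gradient d f u)"
proof -
  obtain g where g: "has_gradient d f u g"
    using assms by (auto simp: L_smooth_def)
  then show ?thesis
    unfolding gradient_def by (rule theI) (rule has_gradient_unique[OF assms(2) _ g])
qed

lemma L_smooth_descent:
  assumes "L_smooth d L f" "u \<in> Rn d" "v \<in> Rn d"
  shows "f v \<le> f u + inner (gradient d f u) (v - u) + L / 2 * (norm (v - u))\<^sup>2"
  using assms gradient_works[OF assms(1)]
  by (intro lipschitz_gradient_descent[OF subspace_imp_convex[OF subspace_Rn]])
    (auto simp: L_smooth_def has_gradient_def)

section \<open>One step of the method\<close>

text \<open>Moves estimates on the domain from the extended reals to the reals.\<close>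

lemma domain_of_eq_ereal:
  assumes "proper_fun d h" "u \<in> domain_of d h"
  shows "h u = ereal (real_of_ereal (h u))"
  using assms by (cases "h u") (auto simp: proper_fun_def domain_of_def)

lemma convex_fun_domain:
  assumes "convex_fun d h" "proper_fun d h" "u \<in> domain_of d h" "v \<in> domain_of d h"
    and t: "t \<in> {0..1}"
  defines "w \<equiv> (1 - t) *\<^sub>R u + t *\<^sub>R v"
  shows "w \<in> domain_of d h"
    and "real_of_ereal (h w) \<le> (1 - t) * real_of_ereal (h u) + t * real_of_ereal (h v)"
proof -
  have uv: "u \<in> Rn d" "v \<in> Rn d"
    using assms by (auto simp: domain_of_def)
  then have w: "w \<in> Rn d"
    unfolding w_def by (intro subspace_add[OF subspace_Rn] subspace_scale[OF subspace_Rn])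
  have "h w \<le> ereal (1 - t) * h u + ereal t * h v"
    using assms uv by (auto simp: convex_fun_def)
  also have "\<dots> = ereal ((1 - t) * real_of_ereal (h u) + t * real_of_ereal (h v))"
    by (subst (1 2) domain_of_eq_ereal[OF assms(2)]) (use assms in auto)
  finally have le: "h w \<le> ereal ((1 - t) * real_of_ereal (h u) + t * real_of_ereal (h v))" .
  then show dom: "w \<in> domain_of d h"
    using w by (auto simp: domain_of_def)
  show "real_of_ereal (h w) \<le> (1 - t) * real_of_ereal (h u) + t * real_of_ereal (h v)"
    using le domain_of_eq_ereal[OF assms(2) dom] by (metis ereal_less_eq(3))
qed

text \<open>The last term is the strong convexity of the squared norm; it produces the extra
  distance term in \<open>prox_three_point\<close>.\<close>

lemma norm_convex_combination_sq:
  fixes p q :: "'a::real_inner"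
  shows "(norm ((1 - t) *\<^sub>R p + t *\<^sub>R q))\<^sup>2 =
    (1 - t) * (norm p)\<^sup>2 + t * (norm q)\<^sup>2 - t * (1 - t) * (norm (p - q))\<^sup>2"
  unfolding power2_norm_eq_inner
  by (simp add: inner_add_left inner_add_right inner_diff_left inner_diff_right inner_commute
      algebra_simps)

text \<open>The minimiser \<open>z'\<close> is compared with points of the segment from
  \<open>z'\<close> to \<open>u\<close>. As these tend to \<open>z'\<close>, the strong convexity of
  the quadratic leaves the gain \<open>\<sigma> * (norm (z' - u))\<^sup>2\<close>.\<close>

lemma prox_three_point:
  assumes h: "convex_fun d h" "proper_fun d h"
    and u: "u \<in> domain_of d h"
    and z': "is_arg_min (\<lambda>u. ereal (inner g u + \<sigma> * (norm (u - z))\<^sup>2) + h u) (\<lambda>u. u \<in> Rn d) z'"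
  shows "z' \<in> domain_of d h"
    and "inner g z' + real_of_ereal (h z') + \<sigma> * (norm (z' - z))\<^sup>2 + \<sigma> * (norm (z' - u))\<^sup>2
      \<le> inner g u + real_of_ereal (h u) + \<sigma> * (norm (u - z))\<^sup>2"
proof -
  let ?H = "\<lambda>u. real_of_ereal (h u)" and ?q = "\<lambda>u. inner g u + \<sigma> * (norm (u - z))\<^sup>2"
  have min: "ereal (?q z') + h z' \<le> ereal (?q v) + h v" if "v \<in> Rn d" for v
    using z' that by (auto simp: is_arg_min_def not_less)
  have "ereal (?q z') + h z' \<le> ereal (?q u) + ereal (?H u)"
    using min[of u] u domain_of_eq_ereal[OF h(2) u] by (simp add: domain_of_def)
  then have "h z' < \<infinity>"
    by (cases "h z'") auto
  then show dom: "z' \<in> domain_of d h"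
    using z' by (auto simp: domain_of_def is_arg_min_def)
  have min': "?q z' + ?H z' \<le> ?q v + ?H v" if "v \<in> domain_of d h" for v
  proof -
    have "ereal (?q z') + ereal (?H z') \<le> ereal (?q v) + ereal (?H v)"
      using min[of v] that domain_of_eq_ereal[OF h(2) dom] domain_of_eq_ereal[OF h(2) that]
      by (simp add: domain_of_def)
    then show ?thesis by simp
  qed
  have step: "?q z' + ?H z' \<le> ?q u + ?H u - \<sigma> * (1 - t) * (norm (z' - u))\<^sup>2"
    if t: "0 < t" "t \<le> 1" for t
  proof -
    let ?w = "(1 - t) *\<^sub>R z' + t *\<^sub>R u"
    have t01: "t \<in> {0..1}" using t by simp
    have "?w - z = (1 - t) *\<^sub>R (z' - z) + t *\<^sub>R (u - z)"
      by (simp add: algebra_simps)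
    then have n: "(norm (?w - z))\<^sup>2 = (1 - t) * (norm (z' - z))\<^sup>2 + t * (norm (u - z))\<^sup>2
        - t * (1 - t) * (norm (z' - u))\<^sup>2"
      using norm_convex_combination_sq[of t "z' - z" "u - z"] by simp
    have "?q z' + ?H z' \<le> ?q ?w + ?H ?w"
      by (rule min') (rule convex_fun_domain(1)[OF h dom u t01])
    also have "\<dots> \<le> ?q ?w + ((1 - t) * ?H z' + t * ?H u)"
      using convex_fun_domain(2)[OF h dom u t01] by simp
    \<comment> \<open>The part \<open>(1 - t) * (?q z' + ?H z')\<close> cancels, so all remaining
      terms carry the factor \<open>t\<close>, which can be divided out before letting
      \<open>t\<close> tend to 0.\<close>
    finally have "t * (?q z' + ?H z') \<le> t * (?q u + ?H u - \<sigma> * (1 - t) * (norm (z' - u))\<^sup>2)"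
      unfolding n by (simp add: inner_add_right algebra_simps)
    then show ?thesis
      using t by simp
  qed
  have "((\<lambda>t. ?q u + ?H u - \<sigma> * (1 - t) * (norm (z' - u))\<^sup>2)
      \<longlongrightarrow> ?q u + ?H u - \<sigma> * (1 - 0) * (norm (z' - u))\<^sup>2) (at_right 0)"
    by (intro tendsto_intros)
  moreover have "\<forall>\<^sub>F t in at_right 0.
      ?q z' + ?H z' \<le> ?q u + ?H u - \<sigma> * (1 - t) * (norm (z' - u))\<^sup>2"
    by (rule eventually_mono[OF eventually_at_right_real[of 0 1]]) (auto intro!: step)
  ultimately have "?q z' + ?H z' \<le> ?q u + ?H u - \<sigma> * (1 - 0) * (norm (z' - u))\<^sup>2"
    by (rule tendsto_lowerbound) simp
  then show "inner g z' + ?H z' + \<sigma> * (norm (z' - z))\<^sup>2 + \<sigma> * (norm (z' - u))\<^sup>2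
      \<le> inner g u + ?H u + \<sigma> * (norm (u - z))\<^sup>2"
    by simp
qed

text \<open>Adds the descent inequality at \<open>x\<close>, the linear lower bounds for
  \<open>f\<close> at \<open>y\<close> and \<open>u\<close> with weights \<open>1 - \<theta>\<close>
  and \<open>\<theta>\<close>, and the three-point inequality scaled by \<open>\<theta>\<close>.
  Later \<open>u\<close> is the minimiser.\<close>

lemma accelerated_step:
  fixes d f h
  defines "F \<equiv> \<lambda>u. f u + real_of_ereal (h u)"
  assumes f: "convex_on (Rn d) f" "L_smooth d L f"
    and h: "convex_fun d h" "proper_fun d h"
    and dom: "u \<in> domain_of d h" "y \<in> domain_of d h" "z \<in> domain_of d h"
    and \<theta>: "0 \<le> \<theta>" "\<theta> \<le> 1"
    and x: "x = (1 - \<theta>) *\<^sub>R y + \<theta> *\<^sub>R z"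
    and z': "is_arg_min (\<lambda>u. ereal (inner (gradient d f x) u + \<sigma> * (norm (u - z))\<^sup>2) + h u)
      (\<lambda>u. u \<in> Rn d) z'"
    and y': "y' = x + \<theta> *\<^sub>R (z' - z)"
  shows "z' \<in> domain_of d h" "y' \<in> domain_of d h"
    and "F y' - F u \<le> (1 - \<theta>) * (F y - F u)
      + \<theta> * \<sigma> * ((norm (z - u))\<^sup>2 - (norm (z' - u))\<^sup>2)
      + (L * \<theta>\<^sup>2 / 2 - \<theta> * \<sigma>) * (norm (z' - z))\<^sup>2"
proof -
  let ?H = "\<lambda>u. real_of_ereal (h u)" and ?g = "gradient d f x"
  have \<theta>01: "\<theta> \<in> {0..1}" using \<theta> by simp
  show dz': "z' \<in> domain_of d h"
    by (rule prox_three_point(1)[OF h dom(1) z'])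
  \<comment> \<open>Thus \<open>y'\<close> is the combination defining \<open>x\<close> with
    \<open>z\<close> replaced by \<open>z'\<close>, so convexity of \<open>h\<close> applies to
    it.\<close>
  have y'_eq: "y' = (1 - \<theta>) *\<^sub>R y + \<theta> *\<^sub>R z'"
    unfolding y' x by (simp add: algebra_simps)
  show dy': "y' \<in> domain_of d h"
    unfolding y'_eq by (rule convex_fun_domain(1)[OF h dom(2) dz' \<theta>01])
  have dx: "x \<in> domain_of d h"
    unfolding x by (rule convex_fun_domain(1)[OF h dom(2,3) \<theta>01])
  have Rn: "u \<in> Rn d" "y \<in> Rn d" "x \<in> Rn d" "y' \<in> Rn d"
    using dom dx dy' by (auto simp: domain_of_def)
  have lin: "f x + inner ?g (v - x) \<le> f v" if "v \<in> Rn d" for v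
    using gradient_works[OF f(2) Rn(3)] Rn that
    by (intro convex_on_gradient_ineq[OF f(1)]) (auto simp: has_gradient_def)
  have "f y' \<le> f x + inner ?g (y' - x) + L / 2 * (norm (y' - x))\<^sup>2"
    by (rule L_smooth_descent[OF f(2) Rn(3,4)])
  moreover have "(norm (y' - x))\<^sup>2 = \<theta>\<^sup>2 * (norm (z' - z))\<^sup>2"
    by (simp add: y' power_mult_distrib)
  moreover have "inner ?g (y' - x) = (1 - \<theta>) * inner ?g (y - x) + \<theta> * inner ?g (z' - x)"
    unfolding y'_eq by (simp add: inner_add_right inner_diff_right algebra_simps)
  moreover have "?H y' \<le> (1 - \<theta>) * ?H y + \<theta> * ?H z'"
    unfolding y'_eq by (rule convex_fun_domain(2)[OF h dom(2) dz' \<theta>01])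
  moreover have "(1 - \<theta>) * (f x + inner ?g (y - x)) \<le> (1 - \<theta>) * f y"
    using lin[OF Rn(2)] \<theta> by (intro mult_left_mono) auto
  moreover have "\<theta> * (f x + inner ?g (u - x)) \<le> \<theta> * f u"
    using lin[OF Rn(1)] \<theta> by (intro mult_left_mono) auto
  moreover have "\<theta> * (inner ?g z' + ?H z' + \<sigma> * (norm (z' - z))\<^sup>2 + \<sigma> * (norm (z' - u))\<^sup>2)
      \<le> \<theta> * (inner ?g u + ?H u + \<sigma> * (norm (z - u))\<^sup>2)"
    using prox_three_point(2)[OF h dom(1) z'] \<theta>
    by (intro mult_left_mono) (auto simp: norm_minus_commute)
  ultimately show "F y' - F u \<le> (1 - \<theta>) * (F y - F u)
      + \<theta> * \<sigma> * ((norm (z - u))\<^sup>2 - (norm (z' - u))\<^sup>2)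
      + (L * \<theta>\<^sup>2 / 2 - \<theta> * \<sigma>) * (norm (z' - z))\<^sup>2"
    unfolding F_def inner_diff_right by (simp add: algebra_simps)
qed

section \<open>Momentum and adaptive step sizes\<close>

text \<open>The recursion picks a root of \<open>X\<^sup>2 - X = (momentum k)\<^sup>2\<close>. With
  \<theta> the reciprocal of the new momentum, the factor \<open>1 - \<theta>\<close> turns its
  square into the previous square, so the energies telescope.\<close>

lemma momentum_Suc_sq: "(momentum (Suc k))\<^sup>2 - momentum (Suc k) = (momentum k)\<^sup>2"
proof -
  define r where "r = sqrt (1 + 4 * (momentum k)\<^sup>2)"
  have "r\<^sup>2 = 1 + 4 * (momentum k)\<^sup>2"
    by (simp add: r_def)
  then show ?thesis
    unfolding momentum.simps r_def[symmetric] by (simp add: power2_eq_square field_simps)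
qed

text \<open>The source of the rate \<open>1 / t\<^sup>2\<close> and of the factor 4 in the
  constant.\<close>

lemma momentum_ge: "real k / 2 \<le> momentum k"
proof (induction k)
  case (Suc k)
  have "real k = sqrt ((real k)\<^sup>2)"
    by simp
  also have "(real k)\<^sup>2 \<le> 1 + 4 * (momentum k)\<^sup>2"
    using power_mono[OF Suc, of 2] by (simp add: power_divide)
  finally have "real k \<le> sqrt (1 + 4 * (momentum k)\<^sup>2)"
    by simp
  then show ?case
    by (simp add: divide_right_mono)
qed simp

lemma momentum_Suc_ge_1: "1 \<le> momentum (Suc k)"
proof -
  have "1 \<le> sqrt (1 + 4 * (momentum k)\<^sup>2)"
    by (rule real_le_rsqrt) simp
  then show ?thesis
    by simp
qed

text \<open>
  The logarithm comes from \<open>\<delta>\<^sup>2 / \<eta>\<^sup>2 = R - 1 \<le> R * ln R\<close> with \<open>R = (s' / s)\<^sup>2\<close>,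
  the linear term from \<open>s'\<^sup>2 - s\<^sup>2 \<ge> 2 * s * (s' - s)\<close>.
\<close>

lemma adaptive_step_growth:
  fixes s s' \<delta> \<eta> D :: real
  assumes pos: "0 < s" "0 < s'" "0 < \<eta>" and "\<bar>\<delta>\<bar> \<le> D"
    and s': "s'\<^sup>2 = s\<^sup>2 * (1 + \<delta>\<^sup>2 / \<eta>\<^sup>2)"
  shows "s \<le> s'"
    and "2 * \<eta>\<^sup>2 * (s' - s) \<le> s * \<delta>\<^sup>2"
    and "\<delta>\<^sup>2 \<le> 2 * (\<eta>\<^sup>2 + D\<^sup>2) * (ln s' - ln s)"
proof -
  define R where "R = 1 + \<delta>\<^sup>2 / \<eta>\<^sup>2"
  have R1: "1 \<le> R" by (simp add: R_def)
  have "s\<^sup>2 \<le> s'\<^sup>2"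
    unfolding s' using pos by (simp add: algebra_simps)
  then show "s \<le> s'"
    by (rule power2_le_imp_le) (use pos in simp)
  have "0 \<le> (s' - s)\<^sup>2" by simp
  then have "s * (2 * (s' - s)) \<le> s'\<^sup>2 - s\<^sup>2"
    by (simp add: power2_eq_square algebra_simps)
  also have "\<dots> = s * (s * (\<delta>\<^sup>2 / \<eta>\<^sup>2))"
    unfolding s' by (simp add: power2_eq_square distrib_left)
  finally have "2 * (s' - s) \<le> s * (\<delta>\<^sup>2 / \<eta>\<^sup>2)"
    using pos(1) by (rule mult_left_le_imp_le)
  then have "\<eta>\<^sup>2 * (2 * (s' - s)) \<le> \<eta>\<^sup>2 * (s * (\<delta>\<^sup>2 / \<eta>\<^sup>2))"
    by (rule mult_left_mono) simp
  also have "\<dots> = s * \<delta>\<^sup>2"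
    using pos by simp
  finally show "2 * \<eta>\<^sup>2 * (s' - s) \<le> s * \<delta>\<^sup>2"
    by (simp only: mult.assoc mult.left_commute[of "\<eta>\<^sup>2" 2])
  have "ln (s'\<^sup>2) = ln (s\<^sup>2) + ln R"
    unfolding s' R_def[symmetric] using pos R1 by (subst ln_mult) auto
  then have lnR: "ln R = 2 * (ln s' - ln s)"
    using pos by (simp add: ln_realpow)
  \<comment> \<open>Multiplying by \<open>R\<close> turns this into
    \<open>R - 1 \<le> R * ln R\<close>.\<close>
  have "ln (inverse R) \<le> inverse R - 1"
    using R1 by (intro ln_le_minus_one) auto
  then have "R * (1 - inverse R) \<le> R * ln R"
    using R1 by (intro mult_left_mono) (auto simp: ln_inverse)
  then have "R - 1 \<le> R * ln R"
    using R1 by (simp add: right_diff_distrib)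
  then have "\<eta>\<^sup>2 * (R - 1) \<le> \<eta>\<^sup>2 * (R * ln R)"
    by (intro mult_left_mono) auto
  moreover have "\<eta>\<^sup>2 * (R - 1) = \<delta>\<^sup>2" and \<eta>R: "\<eta>\<^sup>2 * R = \<eta>\<^sup>2 + \<delta>\<^sup>2"
    using pos by (auto simp: R_def algebra_simps)
  ultimately have "\<delta>\<^sup>2 \<le> (\<eta>\<^sup>2 + \<delta>\<^sup>2) * ln R"
    by (simp add: mult.assoc[symmetric])
  \<comment> \<open>The bound on the step length makes the factor of the logarithm the same in every
    step, so that the logarithms telescope.\<close>
  also have "\<dots> \<le> (\<eta>\<^sup>2 + D\<^sup>2) * ln R"
  proof -
    have "\<delta>\<^sup>2 \<le> D\<^sup>2"
      using power_mono[OF assms(4), of 2] by simp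
    then show ?thesis
      using R1 by (intro mult_right_mono) auto
  qed
  finally show "\<delta>\<^sup>2 \<le> 2 * (\<eta>\<^sup>2 + D\<^sup>2) * (ln s' - ln s)"
    by (simp add: lnR algebra_simps)
qed

text \<open>This is \<open>ln v \<le> v\<close> at \<open>v = a * s / (K + 1)\<close>. Dividing by
  \<open>K + 1\<close> instead of \<open>K\<close> covers \<open>K = 0\<close>, and the absolute
  value keeps the remainder nonnegative.\<close>

lemma ln_le_linear:
  fixes s a K \<gamma> :: real
  assumes "0 < s" "0 < a" "0 < \<gamma>" "0 \<le> K"
  shows "K * (ln s - ln \<gamma>) \<le> a * s + K * \<bar>ln ((K + 1) / (a * \<gamma>))\<bar>"
proof -
  have eq: "ln s - ln \<gamma> = ln (a * s / (K + 1)) + ln ((K + 1) / (a * \<gamma>))"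
    using assms by (simp add: ln_div ln_mult)
  have "ln (a * s / (K + 1)) \<le> a * s / (K + 1)"
    using assms by (intro less_imp_le ln_less_self) auto
  then have "K * (ln s - ln \<gamma>) \<le> K * (a * s / (K + 1) + \<bar>ln ((K + 1) / (a * \<gamma>))\<bar>)"
    unfolding eq using assms by (intro mult_left_mono) linarith+
  moreover have "K * (a * s / (K + 1)) \<le> a * s"
    using assms by (simp add: pos_divide_le_eq algebra_simps)
  ultimately show ?thesis
    by (simp add: distrib_left)
qed

text \<open>The summation, reduced to real sequences. \<open>K\<close> is the factor of the
  logarithm; \<open>a\<close> is what remains of the linear gain \<eta> after paying
  \<open>D\<^sup>2 / (2 * \<eta>)\<close>.\<close>

lemma adaptive_energy_bound:
  fixes S \<delta> r e :: "nat \<Rightarrow> real"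
  assumes pos: "0 < \<gamma>" "0 < \<eta>" "D\<^sup>2 < 2 * \<eta>\<^sup>2" "0 \<le> L"
    and S1: "S 1 = \<gamma>"
    and S: "\<And>k. 1 \<le> k \<Longrightarrow> (S (Suc k))\<^sup>2 = (S k)\<^sup>2 * (1 + (\<delta> k)\<^sup>2 / \<eta>\<^sup>2)"
      "\<And>k. 1 \<le> k \<Longrightarrow> 0 < S (Suc k)"
    and D: "\<And>k. 1 \<le> k \<Longrightarrow> \<bar>\<delta> k\<bar> \<le> D" "\<And>k. 1 \<le> k \<Longrightarrow> \<bar>r k\<bar> \<le> D"
    and e0: "e 0 = 0"
    and e: "\<And>k. 1 \<le> k \<Longrightarrow> e k \<le> e (k - 1) + S k / (2 * \<eta>) * ((r k)\<^sup>2 - (r (Suc k))\<^sup>2)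
      + (L / 2 - S k / (2 * \<eta>)) * (\<delta> k)\<^sup>2"
  defines "K \<equiv> L * (\<eta>\<^sup>2 + D\<^sup>2)" and "a \<equiv> \<eta> - D\<^sup>2 / (2 * \<eta>)"
  shows "e t \<le> \<eta> * \<gamma> + K * \<bar>ln ((K + 1) / (a * \<gamma>))\<bar>"
proof -
  have Spos: "0 < S (Suc k)" for k
    using S1 pos S(2)[of k] by (cases k) auto
  have r2: "(r (Suc k))\<^sup>2 \<le> D\<^sup>2" for k
    using power_mono[OF D(2)[of "Suc k"], of 2] by simp
  \<comment> \<open>Summation by parts as an induction: keeping
    \<open>D\<^sup>2 - (r (Suc k))\<^sup>2\<close>, which is nonnegative, allows its coefficient to
    grow from one value of \<open>S\<close> to the next.\<close>
  have main: "e k \<le> S (Suc k) / (2 * \<eta>) * (D\<^sup>2 - (r (Suc k))\<^sup>2) - \<eta> * (S (Suc k) - \<gamma>)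
      + K * (ln (S (Suc k)) - ln \<gamma>)" for k
  proof (induction k)
    case 0
    then show ?case
      using pos r2[of 0] S1 e0 by simp
  next
    case (Suc k)
    let ?s = "S (Suc k)" and ?s' = "S (Suc (Suc k))" and ?\<delta> = "\<delta> (Suc k)"
    note g = adaptive_step_growth[OF Spos[of k] Spos[of "Suc k"] pos(2), of ?\<delta> D]
    have g1: "?s \<le> ?s'" and g2: "2 * \<eta>\<^sup>2 * (?s' - ?s) \<le> ?s * ?\<delta>\<^sup>2"
      and g3: "?\<delta>\<^sup>2 \<le> 2 * (\<eta>\<^sup>2 + D\<^sup>2) * (ln ?s' - ln ?s)"
      using g S(1)[of "Suc k"] D(1)[of "Suc k"] by auto
    have 1: "?s / (2 * \<eta>) * (D\<^sup>2 - (r (Suc (Suc k)))\<^sup>2)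
        \<le> ?s' / (2 * \<eta>) * (D\<^sup>2 - (r (Suc (Suc k)))\<^sup>2)"
      using g1 pos r2[of "Suc k"] by (intro mult_right_mono divide_right_mono) auto
    have 2: "\<eta> * (?s' - ?s) \<le> ?s / (2 * \<eta>) * ?\<delta>\<^sup>2"
      using g2 pos by (simp add: field_simps power2_eq_square)
    have "L / 2 * ?\<delta>\<^sup>2 \<le> L / 2 * (2 * (\<eta>\<^sup>2 + D\<^sup>2) * (ln ?s' - ln ?s))"
      using g3 pos by (intro mult_left_mono) auto
    then have 3: "L / 2 * ?\<delta>\<^sup>2 \<le> K * (ln ?s' - ln ?s)"
      by (simp add: K_def algebra_simps)
    have "e (Suc k) \<le> e k + ?s / (2 * \<eta>) * ((r (Suc k))\<^sup>2 - (r (Suc (Suc k)))\<^sup>2)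
      + (L / 2 * ?\<delta>\<^sup>2 - ?s / (2 * \<eta>) * ?\<delta>\<^sup>2)"
      using e[of "Suc k"] by (simp add: left_diff_distrib)
    with Suc 1 2 3 show ?case
      unfolding right_diff_distrib by linarith
  qed
  \<comment> \<open>Positivity of \<open>a\<close> is the condition
    \<open>D\<^sup>2 < 2 * \<eta>\<^sup>2\<close>; it lets \<open>a * S (Suc t)\<close> absorb the
    logarithm.\<close>
  have "0 < a"
    using pos by (simp add: a_def pos_divide_less_eq power2_eq_square)
  then have "K * (ln (S (Suc t)) - ln \<gamma>) \<le> a * S (Suc t) + K * \<bar>ln ((K + 1) / (a * \<gamma>))\<bar>"
    using Spos pos by (intro ln_le_linear) (auto simp: K_def)
  moreover have "S (Suc t) / (2 * \<eta>) * (D\<^sup>2 - (r (Suc t))\<^sup>2) \<le> S (Suc t) / (2 * \<eta>) * D\<^sup>2"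
    using Spos[of t] pos by (intro mult_left_mono) auto
  moreover have "a * S (Suc t) = \<eta> * S (Suc t) - S (Suc t) / (2 * \<eta>) * D\<^sup>2"
    by (simp add: a_def left_diff_distrib)
  ultimately show ?thesis
    using main[of t] unfolding right_diff_distrib by linarith
qed

section \<open>The convergence rate\<close>

text \<open>Properness gives a point with finite objective, so the minimum value is below
  infinity.\<close>

lemma arg_min_composite_domain:
  assumes h: "proper_fun d h" and xs: "is_arg_min (composite f h) (\<lambda>u. u \<in> Rn d) xs"
  shows "xs \<in> domain_of d h"
proof -
  obtain u where u: "u \<in> domain_of d h"
    using h by (auto simp: proper_fun_def)
  then have "composite f h xs \<le> composite f h u"
    using xs by (auto simp: is_arg_min_def domain_of_def not_less)
  then have "h xs < \<infinity>"
    using u domain_of_eq_ereal[OF h u] by (cases "h xs"; cases "h u") (auto simp: composite_def)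
  then show ?thesis
    using xs by (auto simp: is_arg_min_def domain_of_def)
qed

text \<open>The constant is explicit in \<open>L\<close>, \<gamma>, \<eta> and \<open>D\<close>, so
  it can be fixed before the dimension, the functions and the iterates.\<close>

lemma adaptive_apg_rate:
  fixes L \<gamma> \<eta> D :: real
  assumes pos: "0 < \<gamma>" "0 < \<eta>" "D\<^sup>2 < 2 * \<eta>\<^sup>2"
    and f: "convex_on (Rn d) f" "L_smooth d L f"
    and h: "convex_fun d h" "proper_fun d h"
    and xs: "is_arg_min (composite f h) (\<lambda>u. u \<in> Rn d) xs"
    and alg: "adaptive_apg d f h \<gamma> \<eta> S x y z"
    and init: "y 1 = z 1" "z 1 \<in> domain_of d h"
    and D: "\<And>k. 1 \<le> k \<Longrightarrow> norm (z (k + 1) - z k) \<le> D" "\<And>k. 1 \<le> k \<Longrightarrow> norm (z k - xs) \<le> D"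
    and t: "1 \<le> t"
  defines "K \<equiv> \<bar>L\<bar> * (\<eta>\<^sup>2 + D\<^sup>2)" and "a \<equiv> \<eta> - D\<^sup>2 / (2 * \<eta>)"
  shows "composite f h (y (t + 1)) - composite f h xs
    \<le> ereal (4 * (\<eta> * \<gamma> + K * \<bar>ln ((K + 1) / (a * \<gamma>))\<bar>) / (real t)\<^sup>2)"
proof -
  define F where "F = (\<lambda>u. f u + real_of_ereal (h u))"
  define M where "M = \<eta> * \<gamma> + K * \<bar>ln ((K + 1) / (a * \<gamma>))\<bar>"
  \<comment> \<open>The momentum at \<open>k\<close> is paired with \<open>y\<close> at
    \<open>Suc k\<close>, so \<open>momentum 0 = 0\<close> gives \<open>e 0 = 0\<close>.\<close>
  define e where "e = (\<lambda>k. (momentum k)\<^sup>2 * (F (y (Suc k)) - F xs))"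
  have L0: "0 \<le> L"
    using f(2) by (auto simp: L_smooth_def lipschitz_on_def)
  have dxs: "xs \<in> domain_of d h"
    by (rule arg_min_composite_domain[OF h(2) xs])
  have S1: "S 1 = \<gamma>"
    and it: "\<And>k. 1 \<le> k \<Longrightarrow> x k = (1 - 1 / momentum k) *\<^sub>R y k + (1 / momentum k) *\<^sub>R z k"
      "\<And>k. 1 \<le> k \<Longrightarrow> is_arg_min (\<lambda>u. ereal (inner (gradient d f (x k)) u
          + 1 / momentum k * S k / (2 * \<eta>) * (norm (u - z k))\<^sup>2) + h u) (\<lambda>u. u \<in> Rn d) (z (Suc k))"
      "\<And>k. 1 \<le> k \<Longrightarrow> y (Suc k) = x k + (1 / momentum k) *\<^sub>R (z (Suc k) - z k)"
    and S: "\<And>k. 1 \<le> k \<Longrightarrow> (S (Suc k))\<^sup>2 = (S k)\<^sup>2 * (1 + (norm (z (Suc k) - z k))\<^sup>2 / \<eta>\<^sup>2)"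
      "\<And>k. 1 \<le> k \<Longrightarrow> 0 < S (Suc k)"
    using alg unfolding adaptive_apg_def Let_def by auto
  have \<theta>: "0 \<le> 1 / momentum k" "1 / momentum k \<le> 1" if "1 \<le> k" for k
    using momentum_Suc_ge_1[of "k - 1"] that by (auto simp del: momentum.simps)
  note step = accelerated_step[OF f h dxs _ _ \<theta> it]
  have dom: "y (Suc k) \<in> domain_of d h \<and> z (Suc k) \<in> domain_of d h" for k
  proof (induction k)
    case (Suc k)
    then show ?case
      using step(1,2)[of "Suc k"] by simp
  qed (use init in auto)
  have e_step: "e k \<le> e (k - 1) + S k / (2 * \<eta>) * ((norm (z k - xs))\<^sup>2 - (norm (z (Suc k) - xs))\<^sup>2)
    + (L / 2 - S k / (2 * \<eta>)) * (norm (z (Suc k) - z k))\<^sup>2" if k: "1 \<le> k" for k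
  proof -
    obtain j where j: "k = Suc j"
      using k by (cases k) auto
    define m where "m = momentum k"
    have m: "1 \<le> m"
      using momentum_Suc_ge_1[of j] by (simp add: m_def j del: momentum.simps)
    \<comment> \<open>Multiplying the one-step estimate by \<open>m\<^sup>2\<close> therefore turns
      its first term into \<open>e (k - 1)\<close>.\<close>
    have mj: "(momentum j)\<^sup>2 = m\<^sup>2 * (1 - 1 / m)"
      using momentum_Suc_sq[of j] m
      by (simp add: m_def j power2_eq_square right_diff_distrib del: momentum.simps)
    have "F (y (Suc k)) - F xs \<le> (1 - 1 / m) * (F (y k) - F xs)
      + 1 / m * (1 / m * S k / (2 * \<eta>)) * ((norm (z k - xs))\<^sup>2 - (norm (z (Suc k) - xs))\<^sup>2)
      + (L * (1 / m)\<^sup>2 / 2 - 1 / m * (1 / m * S k / (2 * \<eta>))) * (norm (z (Suc k) - z k))\<^sup>2"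
      unfolding F_def m_def using step(3)[of k] dom[of j] k by (simp add: j)
    then have "m\<^sup>2 * (F (y (Suc k)) - F xs) \<le> m\<^sup>2 * ((1 - 1 / m) * (F (y k) - F xs)
      + 1 / m * (1 / m * S k / (2 * \<eta>)) * ((norm (z k - xs))\<^sup>2 - (norm (z (Suc k) - xs))\<^sup>2)
      + (L * (1 / m)\<^sup>2 / 2 - 1 / m * (1 / m * S k / (2 * \<eta>))) * (norm (z (Suc k) - z k))\<^sup>2)"
      by (intro mult_left_mono) auto
    also have "\<dots> = e (k - 1)
      + S k / (2 * \<eta>) * ((norm (z k - xs))\<^sup>2 - (norm (z (Suc k) - xs))\<^sup>2)
      + (L / 2 - S k / (2 * \<eta>)) * (norm (z (Suc k) - z k))\<^sup>2"
    proof -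
      \<comment> \<open>Stated for arbitrary reals, so that \<open>m\<^sup>2\<close> is distributed
        over the three terms without expanding them.\<close>
      have "m\<^sup>2 * (p * E + q * A + (l - q) * B)
          = m\<^sup>2 * p * E + (m\<^sup>2 * q) * A + (m\<^sup>2 * l - m\<^sup>2 * q) * B" for p q l E A B :: real
        by (simp only: distrib_left left_diff_distrib right_diff_distrib mult.assoc)
      moreover have "m\<^sup>2 * (1 / m * (1 / m * S k / (2 * \<eta>))) = S k / (2 * \<eta>)"
        and "m\<^sup>2 * (L * (1 / m)\<^sup>2 / 2) = L / 2"
        using m by (simp_all add: power2_eq_square)
      moreover have "e (k - 1) = m\<^sup>2 * (1 - 1 / m) * (F (y k) - F xs)"
        using mj by (simp add: e_def j del: momentum.simps)
      ultimately show ?thesis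
        by (simp only:)
    qed
    finally show ?thesis
      by (simp only: e_def m_def)
  qed
  have "e t \<le> M"
    unfolding M_def K_def a_def abs_of_nonneg[OF L0]
    by (rule adaptive_energy_bound[OF pos L0 S1 S _ _ _ e_step])
      (simp_all add: e_def D[simplified])
  have "(real t / 2)\<^sup>2 \<le> (momentum t)\<^sup>2"
    by (intro power_mono momentum_ge) simp
  moreover have Fdiff: "composite f h u - composite f h xs = ereal (F u - F xs)"
    if "u \<in> domain_of d h" for u
    unfolding composite_def
    by (subst domain_of_eq_ereal[OF h(2) that], subst domain_of_eq_ereal[OF h(2) dxs])
      (simp add: F_def)
  \<comment> \<open>The sign of the gap is needed to replace \<open>(momentum t)\<^sup>2\<close> by
    the smaller \<open>(real t / 2)\<^sup>2\<close>.\<close>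
  moreover have "0 \<le> F (y (Suc t)) - F xs"
  proof -
    have dy: "y (Suc t) \<in> domain_of d h" using dom by blast
    then have "composite f h xs \<le> composite f h (y (Suc t))"
      using xs by (auto simp: is_arg_min_def domain_of_def not_less)
    then show ?thesis
      unfolding composite_def
      by (subst (asm) domain_of_eq_ereal[OF h(2) dy], subst (asm) domain_of_eq_ereal[OF h(2) dxs])
        (simp add: F_def)
  qed
  ultimately have "(real t / 2)\<^sup>2 * (F (y (Suc t)) - F xs) \<le> M"
    using \<open>e t \<le> M\<close> mult_right_mono unfolding e_def by (meson order_trans)
  then have "F (y (Suc t)) - F xs \<le> 4 * M / (real t)\<^sup>2"
    using t by (simp add: field_simps)
  then show ?thesis
    using Fdiff dom[of t] by (simp add: M_def)
qed

theorem corollary4: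
  fixes L \<gamma> \<eta> D \<Delta> :: real
  assumes "\<gamma> > 0" and "D > 0" and "\<eta> > sqrt 2 * D / 2"
  shows "\<exists>c>0. \<forall>(d :: nat) (f :: fsvec \<Rightarrow> real) (h :: fsvec \<Rightarrow> ereal) xs S x y z.
    convex_on (Rn d) f \<and> L_smooth d L f \<and>
    convex_fun d h \<and> proper_fun d h \<and> lsc_fun d h \<and>
    is_arg_min (composite f h) (\<lambda>u. u \<in> Rn d) xs \<and>
    adaptive_apg d f h \<gamma> \<eta> S x y z \<and>
    y 1 = z 1 \<and> z 1 \<in> domain_of d h \<and>
    (\<forall>k\<ge>1. norm (z (k + 1) - z k) \<le> D) \<and>
    (\<forall>k\<ge>1. norm (z k - xs) \<le> D) \<and>
    composite f h (y 1) - composite f h xs = ereal \<Delta>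
    \<longrightarrow> (\<forall>t\<ge>1. composite f h (y (t + 1)) - composite f h xs \<le> ereal (c / (real t)\<^sup>2))"
proof -
  \<comment> \<open>Here \<open>c\<close> is chosen before any \<open>f\<close>, so the sign of
    \<open>L\<close> is still open; the absolute value makes \<open>c\<close> positive in every
    case.\<close>
  define K where "K = \<bar>L\<bar> * (\<eta>\<^sup>2 + D\<^sup>2)"
  define a where "a = \<eta> - D\<^sup>2 / (2 * \<eta>)"
  define c where "c = 4 * (\<eta> * \<gamma> + K * \<bar>ln ((K + 1) / (a * \<gamma>))\<bar>)"
  have "0 < sqrt 2 * D / 2" using assms by simp
  then have \<eta>: "0 < \<eta>" using assms by linarith
  \<comment> \<open>Squaring the assumption on \<eta> gives exactly the condition that makes
    \<open>a\<close> positive.\<close>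
  have "(sqrt 2 * D / 2)\<^sup>2 < \<eta>\<^sup>2"
    using assms by (intro power_strict_mono) auto
  then have D\<eta>: "D\<^sup>2 < 2 * \<eta>\<^sup>2"
    by (simp add: power_mult_distrib power_divide)
  have "0 \<le> K * \<bar>ln ((K + 1) / (a * \<gamma>))\<bar>"
    by (simp add: K_def)
  then have "0 < c"
    using \<eta> assms by (simp add: c_def add_pos_nonneg)
  show ?thesis
  proof (intro exI[of _ c] conjI allI impI \<open>0 < c\<close>, elim conjE)
    fix d f h xs S x y z and t :: nat
    assume f: "convex_on (Rn d) f" "L_smooth d L f"
      and h: "convex_fun d h" "proper_fun d h"
      and xs: "is_arg_min (composite f h) (\<lambda>u. u \<in> Rn d) xs"
      and alg: "adaptive_apg d f h \<gamma> \<eta> S x y z"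
      and init: "y 1 = z 1" "z 1 \<in> domain_of d h"
      and D: "\<forall>k\<ge>1. norm (z (k + 1) - z k) \<le> D" "\<forall>k\<ge>1. norm (z k - xs) \<le> D"
      and t: "1 \<le> t"
    show "composite f h (y (t + 1)) - composite f h xs \<le> ereal (c / (real t)\<^sup>2)"
      unfolding c_def K_def a_def
      by (rule adaptive_apg_rate[OF assms(1) \<eta> D\<eta> f h xs alg init D[rule_format] t])
  qed
qed

end
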